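(* (1) For every $\mathsf{PTS}\alpha$ term $t$: $\mathcal B(\mathcal A(t))=t$. (2) For every $\mathsf{PTSC}\alpha$ term $M$: $M\to_{\mathsf{x}'}^*\mathcal A(\mathcal B(M))$.
   Context: Fix a set $\mathcal S$ of sorts, a denumerable set of variables, and two denumerable sets of meta-variables: term meta-variables $\alpha$ and list meta-variables $\beta$, each with a fixed arity. $\mathsf{PTSC}\alpha$ terms and lists: $M ::= \Pi x^{A}.B \mid \lambda x^{A}.M \mid s \mid x\,l \mid M\,l \mid \langle N/x\rangle_A M \mid \alpha(M_1,\dots,M_n)$, $l ::= [\,] \mid M\cdot l \mid l @ l' \mid \langle N/x\rangle_A l \mid \beta(M_1,\dots,M_n)$ ($\langle N/x\rangle_A$ explicit substitution binding $x$; $\Pi,\lambda$ bind $x$; up to $\alpha$-conversion). System $\mathsf{x}'$: (B1) $M\,[\,]\to M$; (B2) $(x\,l)\,l'\to x\,(l@l')$; (B3) $(M\,l)\,l'\to M\,(l@l')$; (A1) $(M\cdot l')@l\to M\cdot(l'@l)$; (A2) $[\,]@l\to l$; (A3) $(l@l')@l''\to l@(l'@l'')$; (A4) $l@[\,]\to l$; (C1) $\langle P/y\rangle_G(\lambda x^A.M)\to\lambda x^{\langle P/y\rangle_G A}.\langle P/y\rangle_G M$; (C2) $\langle P/y\rangle_G(y\,l)\to P\,(\langle P/y\rangle_G l)$; (C3) $\langle P/y\rangle_G(x\,l)\to x\,(\langle P/y\rangle_G l)$ if $x\neq y$; (C4) $\langle P/y\rangle_G(M\,l)\to(\langle P/y\rangle_G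 M)\,(\langle P/y\rangle_G l)$; (C5) $\langle P/y\rangle_G(\Pi x^A.B)\to\Pi x^{\langle P/y\rangle_G A}.\langle P/y\rangle_G B$; (C6) $\langle P/y\rangle_G s\to s$; (C$\alpha$) $\langle P/y\rangle_G\alpha(M_1,\dots,M_n)\to\alpha(\langle P/y\rangle_G M_1,\dots)$; (D1) $\langle P/y\rangle_G[\,]\to[\,]$; (D2) $\langle P/y\rangle_G(M\cdot l)\to(\langle P/y\rangle_G M)\cdot(\langle P/y\rangle_G l)$; (D3) $\langle P/y\rangle_G(l@l')\to(\langle P/y\rangle_G l)@(\langle P/y\rangle_G l')$; (D$\beta$) $\langle P/y\rangle_G\beta(M_1,\dots,M_n)\to\beta(\langle P/y\rangle_G M_1,\dots)$; $\to_{\mathsf{x}'}$ is the contextual closure, $\to^*_{\mathsf{x}'}$ its reflexive-transitive closure. PTS terms $t,u,T ::= x\mid s\mid\Pi x^T.t\mid\lambda x^T.t\mid t\,u$; $t\{x:=u\}$ is capture-avoiding substitution. For each term (resp. list) meta-variable $\alpha$ (resp. $\beta$) of arity $k$ a PTS variable $\alpha^k$ (resp. $\beta^k$) is reserved. $\mathsf{PTS}\alpha$ is the set of PTS terms in which no reserved variable is bound, each $\alpha^k$ is applied to at least $k$ arguments and each $\beta^k$ to at least $k+1$ arguments. Translation $\mathcal B$: $\mathcal B(\Pi x^A.B)=\Pi x^{\mathcal B(A)}.\mathcal B(B)$, $\mathcal B(\lambda x^A.M)=\lambda x^{\mathcal B(A)}.\mathcal B(M)$, $\mathcal B(s)=s$,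 $\mathcal B(x\,l)=\mathcal B^z(l)\{z:=x\}$, $\mathcal B(M\,l)=\mathcal B^z(l)\{z:=\mathcal B(M)\}$ ($z$ fresh), $\mathcal B(\langle P/x\rangle_K M)=\mathcal B(M)\{x:=\mathcal B(P)\}$, $\mathcal B(\alpha(M_1,\dots,M_n))=\alpha^n\,\mathcal B(M_1)\cdots\mathcal B(M_n)$; $\mathcal B^y([\,])=y$, $\mathcal B^y(M\cdot l)=\mathcal B^z(l)\{z:=y\,\mathcal B(M)\}$, $\mathcal B^y(l@l')=\mathcal B^z(l')\{z:=\mathcal B^y(l)\}$ ($z$ fresh), $\mathcal B^y(\langle P/x\rangle_K l)=\mathcal B^y(l)\{x:=\mathcal B(P)\}$, $\mathcal B^y(\beta(M_1,\dots,M_n))=\beta^n\,y\,\mathcal B(M_1)\cdots\mathcal B(M_n)$. Translation $\mathcal A$: $\mathcal A(s)=s$, $\mathcal A(\Pi x^T.U)=\Pi x^{\mathcal A(T)}.\mathcal A(U)$, $\mathcal A(\lambda x^T.t)=\lambda x^{\mathcal A(T)}.\mathcal A(t)$, $\mathcal A(\alpha^k\,t_1\cdots t_k)=\alpha(\mathcal A(t_1),\dots,\mathcal A(t_k))$, $\mathcal A(\beta^k\,t\,t_1\cdots t_k)=\mathcal A_{\beta(\mathcal A(t_1),\dots,\mathcal A(t_k))}(t)$, $\mathcal A(t)=\mathcal A_{[\,]}(t)$ otherwise; $\mathcal A_l(\alpha^k\,t_1\cdots t_k)=\alpha(\mathcal A(t_1),\dots,\mathcal A(t_k))\,l$, $\mathcal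 A_l(\beta^k\,t\,t_1\cdots t_k)=\mathcal A_{\beta(\mathcal A(t_1),\dots,\mathcal A(t_k))@l}(t)$, $\mathcal A_l(t\,u)=\mathcal A_{\mathcal A(u)\cdot l}(t)$ otherwise, $\mathcal A_l(x)=x\,l$, $\mathcal A_l(t)=\mathcal A(t)\,l$ otherwise (in the displayed $\alpha^k$, $\beta^k$ cases the reserved variable is applied to exactly $k$, resp. $k+1$, arguments). *)

theory Defs
  imports Main
begin

text \<open>
  Terms up to \<open>\<alpha>\<close>-conversion are represented with de Bruijn indices; a free index \<open>n\<close> stands for
  the \<open>n\<close>-th variable of the denumerable set of variables.  Sorts are the elements of the type
  \<open>'s\<close>; the term meta-variables and the list meta-variables are two copies of the natural numbers,
  with arbitrary arity functions \<open>arT\<close> and \<open>arL\<close>, which are parameters of whatever depends on them.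
\<close>

section \<open>Syntax of PTSC\<open>\<alpha>\<close>\<close>

text \<open>
  \<open>TPi A B\<close>, \<open>TLam A M\<close>, \<open>TSub N A M\<close> and \<open>LSub N A l\<close> (the explicit substitutions
  \<open>\<langle>N/x\<rangle>\<^sub>A M\<close> and \<open>\<langle>N/x\<rangle>\<^sub>A l\<close>) bind the index \<open>0\<close> in their last argument only.
\<close>

datatype 's tm =
    TPi "'s tm" "'s tm"
  | TLam "'s tm" "'s tm"
  | TSort 's
  | TVar nat "'s tl"
  | TApp "'s tm" "'s tl"
  | TSub "'s tm" "'s tm" "'s tm"
  | TMeta nat "'s tm list"
and 's tl =
    LNil
  | LCons "'s tm" "'s tl"
  | LCat "'s tl" "'s tl"
  | LSub "'s tm" "'s tm" "'s tl"
  | LMeta nat "'s tm list"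

text \<open>PTSC\<open>\<alpha>\<close> terms and lists: every meta-variable has as many arguments as its arity.\<close>

fun is_ptsc_tm :: "(nat \<Rightarrow> nat) \<Rightarrow> (nat \<Rightarrow> nat) \<Rightarrow> 's tm \<Rightarrow> bool"
  and is_ptsc_tl :: "(nat \<Rightarrow> nat) \<Rightarrow> (nat \<Rightarrow> nat) \<Rightarrow> 's tl \<Rightarrow> bool"
where
  "is_ptsc_tm arT arL (TPi A B) = (is_ptsc_tm arT arL A \<and> is_ptsc_tm arT arL B)"
| "is_ptsc_tm arT arL (TLam A M) = (is_ptsc_tm arT arL A \<and> is_ptsc_tm arT arL M)"
| "is_ptsc_tm arT arL (TSort s) = True"
| "is_ptsc_tm arT arL (TVar x l) = is_ptsc_tl arT arL l"
| "is_ptsc_tm arT arL (TApp M l) = (is_ptsc_tm arT arL M \<and> is_ptsc_tl arT arL l)"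
| "is_ptsc_tm arT arL (TSub N A M) =
    (is_ptsc_tm arT arL N \<and> is_ptsc_tm arT arL A \<and> is_ptsc_tm arT arL M)"
| "is_ptsc_tm arT arL (TMeta a Ms) =
    (length Ms = arT a \<and> (\<forall>M\<in>set Ms. is_ptsc_tm arT arL M))"
| "is_ptsc_tl arT arL LNil = True"
| "is_ptsc_tl arT arL (LCons M l) = (is_ptsc_tm arT arL M \<and> is_ptsc_tl arT arL l)"
| "is_ptsc_tl arT arL (LCat l l') = (is_ptsc_tl arT arL l \<and> is_ptsc_tl arT arL l')"
| "is_ptsc_tl arT arL (LSub N A l) =
    (is_ptsc_tm arT arL N \<and> is_ptsc_tm arT arL A \<and> is_ptsc_tl arT arL l)"
| "is_ptsc_tl arT arL (LMeta b Ms) =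
    (length Ms = arL b \<and> (\<forall>M\<in>set Ms. is_ptsc_tm arT arL M))"

text \<open>Renamings, and their extension under a binder.\<close>

definition up_ren :: "(nat \<Rightarrow> nat) \<Rightarrow> nat \<Rightarrow> nat" where
  "up_ren f n = (case n of 0 \<Rightarrow> 0 | Suc m \<Rightarrow> Suc (f m))"

fun ren_tm :: "(nat \<Rightarrow> nat) \<Rightarrow> 's tm \<Rightarrow> 's tm"
  and ren_tl :: "(nat \<Rightarrow> nat) \<Rightarrow> 's tl \<Rightarrow> 's tl"
where
  "ren_tm f (TPi A B) = TPi (ren_tm f A) (ren_tm (up_ren f) B)"
| "ren_tm f (TLam A M) = TLam (ren_tm f A) (ren_tm (up_ren f) M)"
| "ren_tm f (TSort s) = TSort s"
| "ren_tm f (TVar x l) = TVar (f x) (ren_tl f l)"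
| "ren_tm f (TApp M l) = TApp (ren_tm f M) (ren_tl f l)"
| "ren_tm f (TSub N A M) = TSub (ren_tm f N) (ren_tm f A) (ren_tm (up_ren f) M)"
| "ren_tm f (TMeta a Ms) = TMeta a (map (ren_tm f) Ms)"
| "ren_tl f LNil = LNil"
| "ren_tl f (LCons M l) = LCons (ren_tm f M) (ren_tl f l)"
| "ren_tl f (LCat l l') = LCat (ren_tl f l) (ren_tl f l')"
| "ren_tl f (LSub N A l) = LSub (ren_tm f N) (ren_tm f A) (ren_tl (up_ren f) l)"
| "ren_tl f (LMeta b Ms) = LMeta b (map (ren_tm f) Ms)"

text \<open>
  \<open>lift_tm\<close> and \<open>lift_tl\<close> weaken by one fresh variable, which gets index \<open>0\<close>;
  \<open>swap_tm\<close> exchanges the two innermost bound variables.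
\<close>

abbreviation lift_tm :: "'s tm \<Rightarrow> 's tm" where
  "lift_tm \<equiv> ren_tm Suc"

abbreviation lift_tl :: "'s tl \<Rightarrow> 's tl" where
  "lift_tl \<equiv> ren_tl Suc"

abbreviation swap_tm :: "'s tm \<Rightarrow> 's tm" where
  "swap_tm \<equiv> ren_tm (id(0 := 1, 1 := 0))"

section \<open>System \<open>x'\<close>\<close>

text \<open>
  In \<open>C1\<close> and \<open>C5\<close> the scope of the explicit substitution and that of the abstraction are
  interchanged, so the two innermost indices are swapped in the body and \<open>P\<close>, \<open>G\<close> are weakened.
  In \<open>C2\<close> and \<open>C3\<close> the substituted variable is the index \<open>0\<close>; any other variable is
  \<open>Suc x\<close>, which becomes \<open>x\<close> once the binder is gone.
\<close>

inductive red_tm :: "'s tm \<Rightarrow> 's tm \<Rightarrow> bool"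
  and red_tl :: "'s tl \<Rightarrow> 's tl \<Rightarrow> bool"
where
  B1: "red_tm (TApp M LNil) M"
| B2: "red_tm (TApp (TVar x l) l') (TVar x (LCat l l'))"
| B3: "red_tm (TApp (TApp M l) l') (TApp M (LCat l l'))"
| A1: "red_tl (LCat (LCons M l') l) (LCons M (LCat l' l))"
| A2: "red_tl (LCat LNil l) l"
| A3: "red_tl (LCat (LCat l l') l'') (LCat l (LCat l' l''))"
| A4: "red_tl (LCat l LNil) l"
| C1: "red_tm (TSub P G (TLam A M))
         (TLam (TSub P G A) (TSub (lift_tm P) (lift_tm G) (swap_tm M)))"
| C2: "red_tm (TSub P G (TVar 0 l)) (TApp P (LSub P G l))"
| C3: "red_tm (TSub P G (TVar (Suc x) l)) (TVar x (LSub P G l))"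
| C4: "red_tm (TSub P G (TApp M l)) (TApp (TSub P G M) (LSub P G l))"
| C5: "red_tm (TSub P G (TPi A B))
         (TPi (TSub P G A) (TSub (lift_tm P) (lift_tm G) (swap_tm B)))"
| C6: "red_tm (TSub P G (TSort s)) (TSort s)"
| Calpha: "red_tm (TSub P G (TMeta a Ms)) (TMeta a (map (TSub P G) Ms))"
| D1: "red_tl (LSub P G LNil) LNil"
| D2: "red_tl (LSub P G (LCons M l)) (LCons (TSub P G M) (LSub P G l))"
| D3: "red_tl (LSub P G (LCat l l')) (LCat (LSub P G l) (LSub P G l'))"
| Dbeta: "red_tl (LSub P G (LMeta b Ms)) (LMeta b (map (TSub P G) Ms))"
  \<comment> \<open>contextual closure\<close>
| TPi1: "red_tm A A' \<Longrightarrow> red_tm (TPi A B) (TPi A' B)"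
| TPi2: "red_tm B B' \<Longrightarrow> red_tm (TPi A B) (TPi A B')"
| TLam1: "red_tm A A' \<Longrightarrow> red_tm (TLam A M) (TLam A' M)"
| TLam2: "red_tm M M' \<Longrightarrow> red_tm (TLam A M) (TLam A M')"
| TVar1: "red_tl l l' \<Longrightarrow> red_tm (TVar x l) (TVar x l')"
| TApp1: "red_tm M M' \<Longrightarrow> red_tm (TApp M l) (TApp M' l)"
| TApp2: "red_tl l l' \<Longrightarrow> red_tm (TApp M l) (TApp M l')"
| TSub1: "red_tm N N' \<Longrightarrow> red_tm (TSub N A M) (TSub N' A M)"
| TSub2: "red_tm A A' \<Longrightarrow> red_tm (TSub N A M) (TSub N A' M)"
| TSub3: "red_tm M M' \<Longrightarrow> red_tm (TSub N A M) (TSub N A M')"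
| TMeta1: "red_tm M M' \<Longrightarrow> red_tm (TMeta a (Ms @ M # Ns)) (TMeta a (Ms @ M' # Ns))"
| LCons1: "red_tm M M' \<Longrightarrow> red_tl (LCons M l) (LCons M' l)"
| LCons2: "red_tl l l' \<Longrightarrow> red_tl (LCons M l) (LCons M l')"
| LCat1: "red_tl l l1 \<Longrightarrow> red_tl (LCat l l') (LCat l1 l')"
| LCat2: "red_tl l' l1 \<Longrightarrow> red_tl (LCat l l') (LCat l l1)"
| LSub1: "red_tm N N' \<Longrightarrow> red_tl (LSub N A l) (LSub N' A l)"
| LSub2: "red_tm A A' \<Longrightarrow> red_tl (LSub N A l) (LSub N A' l)"
| LSub3: "red_tl l l' \<Longrightarrow> red_tl (LSub N A l) (LSub N A l')"
| LMeta1: "red_tm M M' \<Longrightarrow> red_tl (LMeta b (Ms @ M # Ns)) (LMeta b (Ms @ M' # Ns))"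

section \<open>Syntax of PTS and PTS\<open>\<alpha>\<close>\<close>

text \<open>
  The variables of PTS are the ordinary ones, shared with PTSC\<open>\<alpha>\<close>, and one reserved
  variable for every meta-variable: \<open>ResT a\<close> is \<open>\<alpha>\<^sup>k\<close> with \<open>k = arT a\<close> and \<open>ResL b\<close> is
  \<open>\<beta>\<^sup>k\<close> with \<open>k = arL b\<close>.  Only ordinary variables are indices, so that a reserved variable is
  never bound.
\<close>

datatype ptsvar = Ord nat | ResT nat | ResL nat

datatype 's pts =
    PVar ptsvar
  | PSort 's
  | PPi "'s pts" "'s pts"
  | PLam "'s pts" "'s pts"
  | PApp "'s pts" "'s pts"

abbreviation papps :: "'s pts \<Rightarrow> 's pts list \<Rightarrow> 's pts" where
  "papps \<equiv> foldl PApp"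

text \<open>\<open>res_ok arT arL n t\<close>: the condition on reserved variables holds in \<open>t u\<^sub>1 \<dots> u\<^sub>n\<close>, up to
  the arguments \<open>u\<^sub>1, \<dots>, u\<^sub>n\<close>.\<close>

fun res_ok :: "(nat \<Rightarrow> nat) \<Rightarrow> (nat \<Rightarrow> nat) \<Rightarrow> nat \<Rightarrow> 's pts \<Rightarrow> bool" where
  "res_ok arT arL n (PVar (Ord x)) = True"
| "res_ok arT arL n (PVar (ResT a)) = (arT a \<le> n)"
| "res_ok arT arL n (PVar (ResL b)) = (arL b + 1 \<le> n)"
| "res_ok arT arL n (PSort s) = True"
| "res_ok arT arL n (PPi T U) = (res_ok arT arL 0 T \<and> res_ok arT arL 0 U)"
| "res_ok arT arL n (PLam T t) = (res_ok arT arL 0 T \<and> res_ok arT arL 0 t)"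
| "res_ok arT arL n (PApp t u) = (res_ok arT arL (Suc n) t \<and> res_ok arT arL 0 u)"

definition PTSalpha :: "(nat \<Rightarrow> nat) \<Rightarrow> (nat \<Rightarrow> nat) \<Rightarrow> 's pts set" where
  "PTSalpha arT arL = {t. res_ok arT arL 0 t}"

text \<open>Capture-avoiding substitution; \<open>pinst u t\<close> is \<open>t{x := u}\<close> where \<open>x\<close> is the index \<open>0\<close> of
  \<open>t\<close>, which disappears (the other indices are decremented).\<close>

fun ren_pts :: "(nat \<Rightarrow> nat) \<Rightarrow> 's pts \<Rightarrow> 's pts" where
  "ren_pts f (PVar (Ord x)) = PVar (Ord (f x))"
| "ren_pts f (PVar (ResT a)) = PVar (ResT a)"
| "ren_pts f (PVar (ResL b)) = PVar (ResL b)"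
| "ren_pts f (PSort s) = PSort s"
| "ren_pts f (PPi T U) = PPi (ren_pts f T) (ren_pts (up_ren f) U)"
| "ren_pts f (PLam T t) = PLam (ren_pts f T) (ren_pts (up_ren f) t)"
| "ren_pts f (PApp t u) = PApp (ren_pts f t) (ren_pts f u)"

definition up_sub :: "(nat \<Rightarrow> 's pts) \<Rightarrow> nat \<Rightarrow> 's pts" where
  "up_sub \<sigma> n = (case n of 0 \<Rightarrow> PVar (Ord 0) | Suc m \<Rightarrow> ren_pts Suc (\<sigma> m))"

fun sub_pts :: "(nat \<Rightarrow> 's pts) \<Rightarrow> 's pts \<Rightarrow> 's pts" where
  "sub_pts \<sigma> (PVar (Ord x)) = \<sigma> x"
| "sub_pts \<sigma> (PVar (ResT a)) = PVar (ResT a)"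
| "sub_pts \<sigma> (PVar (ResL b)) = PVar (ResL b)"
| "sub_pts \<sigma> (PSort s) = PSort s"
| "sub_pts \<sigma> (PPi T U) = PPi (sub_pts \<sigma> T) (sub_pts (up_sub \<sigma>) U)"
| "sub_pts \<sigma> (PLam T t) = PLam (sub_pts \<sigma> T) (sub_pts (up_sub \<sigma>) t)"
| "sub_pts \<sigma> (PApp t u) = PApp (sub_pts \<sigma> t) (sub_pts \<sigma> u)"

definition pinst :: "'s pts \<Rightarrow> 's pts \<Rightarrow> 's pts" where
  "pinst u t = sub_pts (\<lambda>n. case n of 0 \<Rightarrow> u | Suc m \<Rightarrow> PVar (Ord m)) t"

section \<open>The translation \<open>\<B>\<close>\<close>

text \<open>Renaming-invariant size, for termination.\<close>

fun nodes_tm :: "'s tm \<Rightarrow> nat" and nodes_tl :: "'s tl \<Rightarrow> nat" where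
  "nodes_tm (TPi A B) = Suc (nodes_tm A + nodes_tm B)"
| "nodes_tm (TLam A M) = Suc (nodes_tm A + nodes_tm M)"
| "nodes_tm (TSort s) = 1"
| "nodes_tm (TVar x l) = Suc (nodes_tl l)"
| "nodes_tm (TApp M l) = Suc (nodes_tm M + nodes_tl l)"
| "nodes_tm (TSub N A M) = Suc (nodes_tm N + nodes_tm A + nodes_tm M)"
| "nodes_tm (TMeta a Ms) = Suc (sum_list (map nodes_tm Ms))"
| "nodes_tl LNil = 1"
| "nodes_tl (LCons M l) = Suc (nodes_tm M + nodes_tl l)"
| "nodes_tl (LCat l l') = Suc (nodes_tl l + nodes_tl l')"
| "nodes_tl (LSub N A l) = Suc (nodes_tm N + nodes_tm A + nodes_tl l)"
| "nodes_tl (LMeta b Ms) = Suc (sum_list (map nodes_tm Ms))"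

lemma nodes_ren [simp]:
  fixes M :: "'s tm" and l :: "'s tl"
  shows "nodes_tm (ren_tm f M) = nodes_tm M" and "nodes_tl (ren_tl g l) = nodes_tl l"
  by (induction f M and g l rule: ren_tm_ren_tl.induct)
    (simp_all add: comp_def cong: map_cong)

lemma nodes_arg: "M \<in> set Ms \<Longrightarrow> nodes_tm M < Suc (sum_list (map nodes_tm Ms))"
  by (simp add: less_Suc_eq_le member_le_sum_list)

text \<open>
  \<open>trB M\<close> is \<open>\<B>(M)\<close> and \<open>trBl y l\<close> is \<open>\<B>\<^sup>y(l)\<close>.  A fresh \<open>z\<close> is obtained by weakening \<open>l\<close> and
  taking \<open>z = 0\<close>; under the explicit substitution the variable \<open>y\<close> is called \<open>Suc y\<close>.
\<close>

function (sequential) trB :: "'s tm \<Rightarrow> 's pts" and trBl :: "nat \<Rightarrow> 's tl \<Rightarrow> 's pts" where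
  "trB (TPi A B) = PPi (trB A) (trB B)"
| "trB (TLam A M) = PLam (trB A) (trB M)"
| "trB (TSort s) = PSort s"
| "trB (TVar x l) = pinst (PVar (Ord x)) (trBl 0 (lift_tl l))"
| "trB (TApp M l) = pinst (trB M) (trBl 0 (lift_tl l))"
| "trB (TSub P K M) = pinst (trB P) (trB M)"
| "trB (TMeta a Ms) = papps (PVar (ResT a)) (map trB Ms)"
| "trBl y LNil = PVar (Ord y)"
| "trBl y (LCons M l) = pinst (PApp (PVar (Ord y)) (trB M)) (trBl 0 (lift_tl l))"
| "trBl y (LCat l l') = pinst (trBl y l) (trBl 0 (lift_tl l'))"
| "trBl y (LSub P K l) = pinst (trB P) (trBl (Suc y) l)"
| "trBl y (LMeta b Ms) = papps (PApp (PVar (ResL b)) (PVar (Ord y))) (map trB Ms)"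
  by pat_completeness auto
termination
  by (relation "measure (case_sum nodes_tm (\<lambda>(y, l). nodes_tl l))") (auto simp: nodes_arg)

section \<open>The translation \<open>\<A>\<close>\<close>

text \<open>
  \<open>mv_view arT arL t\<close> recognises the terms \<open>\<alpha>\<^sup>k t\<^sub>1 \<dots> t\<^sub>k\<close> and \<open>\<beta>\<^sup>k u t\<^sub>1 \<dots> t\<^sub>k\<close>, where the
  reserved variable has exactly \<open>k\<close>, respectively \<open>k + 1\<close>, arguments.
\<close>

datatype 's mv_view = ViewT nat "'s pts list" | ViewL nat "'s pts" "'s pts list" | NoView

fun strip_papps :: "'s pts \<Rightarrow> 's pts list \<Rightarrow> 's pts \<times> 's pts list" where
  "strip_papps (PApp t u) us = strip_papps t (u # us)"
| "strip_papps t us = (t, us)"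

definition mv_view :: "(nat \<Rightarrow> nat) \<Rightarrow> (nat \<Rightarrow> nat) \<Rightarrow> 's pts \<Rightarrow> 's mv_view" where
  "mv_view arT arL t =
    (case strip_papps t [] of
      (PVar (ResT a), ts) \<Rightarrow> if length ts = arT a then ViewT a ts else NoView
    | (PVar (ResL b), u # ts) \<Rightarrow> if length ts = arL b then ViewL b u ts else NoView
    | _ \<Rightarrow> NoView)"

lemma strip_papps_eq: "strip_papps t us = (h, ts) \<Longrightarrow> papps h ts = papps t us"
  by (induction t us rule: strip_papps.induct) auto

lemma strip_papps_papps: "strip_papps (papps t us) vs = strip_papps t (us @ vs)"
  by (induction us arbitrary: t vs rule: rev_induct) auto

lemma mv_view_ViewT_iff:
  "mv_view arT arL t = ViewT a ts \<longleftrightarrow> t = papps (PVar (ResT a)) ts \<and> length ts = arT a"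
    (is "?l \<longleftrightarrow> ?r")
proof
  show "?r \<Longrightarrow> ?l" by (auto simp: mv_view_def strip_papps_papps)
  obtain h us where h: "strip_papps t [] = (h, us)" by fastforce
  show "?l \<Longrightarrow> ?r" using strip_papps_eq[OF h] h
    by (auto simp: mv_view_def split: pts.splits ptsvar.splits list.splits if_splits)
qed

lemma mv_view_ViewL_iff:
  "mv_view arT arL t = ViewL b u ts \<longleftrightarrow> t = papps (PVar (ResL b)) (u # ts) \<and> length ts = arL b"
    (is "?l \<longleftrightarrow> ?r")
proof
  show "?r \<Longrightarrow> ?l" by (auto simp: mv_view_def strip_papps_papps)
  obtain h us where h: "strip_papps t [] = (h, us)" by fastforce
  show "?l \<Longrightarrow> ?r" using strip_papps_eq[OF h] h
    by (auto simp: mv_view_def split: pts.splits ptsvar.splits list.splits if_splits)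
qed

fun nodes_pts :: "'s pts \<Rightarrow> nat" where
  "nodes_pts (PVar x) = 1"
| "nodes_pts (PSort s) = 1"
| "nodes_pts (PPi T U) = Suc (nodes_pts T + nodes_pts U)"
| "nodes_pts (PLam T t) = Suc (nodes_pts T + nodes_pts t)"
| "nodes_pts (PApp t u) = Suc (nodes_pts t + nodes_pts u)"

lemma nodes_papps: "nodes_pts (papps t ts) = nodes_pts t + sum_list (map (\<lambda>u. Suc (nodes_pts u)) ts)"
  by (induction ts arbitrary: t) auto

lemma nodes_papps_arg:
  assumes "u \<in> set ts" shows "nodes_pts u < nodes_pts (papps t ts)"
proof -
  have "Suc (nodes_pts u) \<le> sum_list (map (\<lambda>u. Suc (nodes_pts u)) ts)"
    using assms by (intro member_le_sum_list) auto
  then show ?thesis by (simp add: nodes_papps)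
qed

lemma mv_view_ViewT_less:
  "mv_view arT arL t = ViewT a ts \<Longrightarrow> u \<in> set ts \<Longrightarrow> nodes_pts u < nodes_pts t"
  by (auto simp: mv_view_ViewT_iff nodes_papps_arg simp del: foldl_Cons)

lemma mv_view_ViewL_less:
  "mv_view arT arL t = ViewL b v ts \<Longrightarrow> u \<in> insert v (set ts) \<Longrightarrow> nodes_pts u < nodes_pts t"
  using nodes_papps_arg[of u "v # ts" "PVar (ResL b)"]
  by (auto simp: mv_view_ViewL_iff simp del: foldl_Cons)

text \<open>
  \<open>trA arT arL t\<close> is \<open>\<A>(t)\<close> and \<open>trAl arT arL l t\<close> is \<open>\<A>\<^sub>l(t)\<close>.  The value \<open>undefined\<close> is only
  reached outside PTS\<open>\<alpha>\<close>, on a reserved variable with too few arguments.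
\<close>

function trA :: "(nat \<Rightarrow> nat) \<Rightarrow> (nat \<Rightarrow> nat) \<Rightarrow> 's pts \<Rightarrow> 's tm"
  and trAl :: "(nat \<Rightarrow> nat) \<Rightarrow> (nat \<Rightarrow> nat) \<Rightarrow> 's tl \<Rightarrow> 's pts \<Rightarrow> 's tm"
where
  "trA arT arL t =
    (case t of
      PSort s \<Rightarrow> TSort s
    | PPi T U \<Rightarrow> TPi (trA arT arL T) (trA arT arL U)
    | PLam T u \<Rightarrow> TLam (trA arT arL T) (trA arT arL u)
    | _ \<Rightarrow>
      (case mv_view arT arL t of
        ViewT a ts \<Rightarrow> TMeta a (map (trA arT arL) ts)
      | ViewL b u ts \<Rightarrow> trAl arT arL (LMeta b (map (trA arT arL) ts)) u
      | NoView \<Rightarrow> trAl arT arL LNil t))"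
| "trAl arT arL l t =
    (case mv_view arT arL t of
      ViewT a ts \<Rightarrow> TApp (TMeta a (map (trA arT arL) ts)) l
    | ViewL b u ts \<Rightarrow> trAl arT arL (LCat (LMeta b (map (trA arT arL) ts)) l) u
    | NoView \<Rightarrow>
      (case t of
        PApp u v \<Rightarrow> trAl arT arL (LCons (trA arT arL v) l) u
      | PVar (Ord x) \<Rightarrow> TVar x l
      | PVar _ \<Rightarrow> undefined
      | _ \<Rightarrow> TApp (trA arT arL t) l))"
  by pat_completeness auto
termination
  by (relation "measure (case_sum
      (\<lambda>(arT, arL, t). 3 * nodes_pts t + (case t of PVar x \<Rightarrow> 2 | PApp u v \<Rightarrow> 2 | _ \<Rightarrow> 0))
      (\<lambda>(arT, arL, l, t). 3 * nodes_pts t + 1))")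
    (auto split: pts.splits dest!: mv_view_ViewT_less mv_view_ViewL_less)

declare trA.simps [simp del] trAl.simps [simp del]

text \<open>The defining equations of \<open>\<A>\<close> as they are usually written.\<close>

lemma papps_PVar_neq [simp]:
  "papps (PVar x) ts \<noteq> PSort s" "papps (PVar x) ts \<noteq> PPi T U" "papps (PVar x) ts \<noteq> PLam T u"
  by (cases ts rule: rev_cases; simp)+

lemma mv_view_simps [simp]:
  "mv_view arT arL (PSort s) = NoView" "mv_view arT arL (PPi T U) = NoView"
  "mv_view arT arL (PLam T u) = NoView" "mv_view arT arL (PVar (Ord x)) = NoView"
  by (simp_all add: mv_view_def)

lemma trA_eqs:
  "trA arT arL (PSort s) = TSort s"
  "trA arT arL (PPi T U) = TPi (trA arT arL T) (trA arT arL U)"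
  "trA arT arL (PLam T t) = TLam (trA arT arL T) (trA arT arL t)"
  "length ts = arT a \<Longrightarrow>
    trA arT arL (papps (PVar (ResT a)) ts) = TMeta a (map (trA arT arL) ts)"
  "length ts = arL b \<Longrightarrow>
    trA arT arL (papps (PVar (ResL b)) (t # ts)) = trAl arT arL (LMeta b (map (trA arT arL) ts)) t"
  "trA arT arL (PVar (Ord x)) = trAl arT arL LNil (PVar (Ord x))"
  "mv_view arT arL (PApp t u) = NoView \<Longrightarrow>
    trA arT arL (PApp t u) = trAl arT arL LNil (PApp t u)"
proof -
  assume l: "length ts = arT a"
  then have "mv_view arT arL (papps (PVar (ResT a)) ts) = ViewT a ts"
    by (simp add: mv_view_ViewT_iff)
  then show "trA arT arL (papps (PVar (ResT a)) ts) = TMeta a (map (trA arT arL) ts)"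
    by (subst trA.simps) (auto split: pts.splits)
next
  assume l: "length ts = arL b"
  then have "mv_view arT arL (papps (PVar (ResL b)) (t # ts)) = ViewL b t ts"
    by (simp only: mv_view_ViewL_iff)
  moreover have "papps (PVar (ResL b)) (t # ts) \<noteq> PSort s"
    "papps (PVar (ResL b)) (t # ts) \<noteq> PPi T U" "papps (PVar (ResL b)) (t # ts) \<noteq> PLam T u"
    for s T U u by (simp_all only: papps_PVar_neq not_False_eq_True)
  ultimately show "trA arT arL (papps (PVar (ResL b)) (t # ts)) =
      trAl arT arL (LMeta b (map (trA arT arL) ts)) t"
    by (subst trA.simps) (auto split: pts.splits simp del: foldl_Cons)
qed (subst trA.simps, simp)+

lemma trAl_eqs:
  "length ts = arT a \<Longrightarrow>
    trAl arT arL l (papps (PVar (ResT a)) ts) = TApp (TMeta a (map (trA arT arL) ts)) l"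
  "length ts = arL b \<Longrightarrow>
    trAl arT arL l (papps (PVar (ResL b)) (t # ts)) =
      trAl arT arL (LCat (LMeta b (map (trA arT arL) ts)) l) t"
  "mv_view arT arL (PApp t u) = NoView \<Longrightarrow>
    trAl arT arL l (PApp t u) = trAl arT arL (LCons (trA arT arL u) l) t"
  "trAl arT arL l (PVar (Ord x)) = TVar x l"
  "trAl arT arL l (PSort s) = TApp (trA arT arL (PSort s)) l"
  "trAl arT arL l (PPi T U) = TApp (trA arT arL (PPi T U)) l"
  "trAl arT arL l (PLam T v) = TApp (trA arT arL (PLam T v)) l"
proof -
  assume l: "length ts = arT a"
  then have "mv_view arT arL (papps (PVar (ResT a)) ts) = ViewT a ts"
    by (simp add: mv_view_ViewT_iff)
  then show "trAl arT arL l (papps (PVar (ResT a)) ts) = TApp (TMeta a (map (trA arT arL) ts)) l"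
    by (subst trAl.simps) simp
next
  assume l: "length ts = arL b"
  then have "mv_view arT arL (papps (PVar (ResL b)) (t # ts)) = ViewL b t ts"
    by (simp only: mv_view_ViewL_iff)
  then show "trAl arT arL l (papps (PVar (ResL b)) (t # ts)) =
      trAl arT arL (LCat (LMeta b (map (trA arT arL) ts)) l) t"
    by (subst trAl.simps) (simp del: foldl_Cons)
qed (subst trAl.simps, simp)+

text \<open>The translations map PTS\<open>\<alpha>\<close> to PTSC\<open>\<alpha>\<close> and conversely.\<close>

lemma res_ok_papps:
  "res_ok arT arL n (papps t ts) \<longleftrightarrow>
    res_ok arT arL (n + length ts) t \<and> (\<forall>u\<in>set ts. res_ok arT arL 0 u)"
  by (induction ts arbitrary: t) auto

lemma is_ptsc_ren:
  fixes M :: "'s tm" and l :: "'s tl"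
  shows "is_ptsc_tm arT arL (ren_tm f M) = is_ptsc_tm arT arL M"
    and "is_ptsc_tl arT arL (ren_tl g l) = is_ptsc_tl arT arL l"
  by (induction f M and g l rule: ren_tm_ren_tl.induct) auto

lemma res_ok_mono: "res_ok arT arL n t \<Longrightarrow> n \<le> m \<Longrightarrow> res_ok arT arL m t"
  by (induction arT arL n t arbitrary: m rule: res_ok.induct) auto

lemma res_ok_ren: "res_ok arT arL n (ren_pts f t) = res_ok arT arL n t"
  by (induction f t arbitrary: n rule: ren_pts.induct) auto

lemma res_ok_sub:
  "res_ok arT arL n t \<Longrightarrow> (\<And>x. res_ok arT arL 0 (\<sigma> x)) \<Longrightarrow> res_ok arT arL n (sub_pts \<sigma> t)"
proof (induction \<sigma> t arbitrary: n rule: sub_pts.induct)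
  case (5 \<sigma> T U)
  then have "res_ok arT arL 0 (up_sub \<sigma> x)" for x
    by (auto simp: up_sub_def res_ok_ren split: nat.splits)
  with 5 show ?case by simp
next
  case (6 \<sigma> T U)
  then have "res_ok arT arL 0 (up_sub \<sigma> x)" for x
    by (auto simp: up_sub_def res_ok_ren split: nat.splits)
  with 6 show ?case by simp
qed (auto intro: res_ok_mono)

lemma res_ok_pinst:
  "res_ok arT arL 0 u \<Longrightarrow> res_ok arT arL 0 t \<Longrightarrow> res_ok arT arL 0 (pinst u t)"
  by (auto simp: pinst_def intro!: res_ok_sub split: nat.splits)

lemma trB_res_ok:
  fixes M :: "'s tm" and l :: "'s tl"
  shows "is_ptsc_tm arT arL M \<Longrightarrow> res_ok arT arL 0 (trB M)"
    and "is_ptsc_tl arT arL l \<Longrightarrow> res_ok arT arL 0 (trBl y l)"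
  by (induction M and y l rule: trB_trBl.induct)
    (auto simp: is_ptsc_ren res_ok_papps intro!: res_ok_pinst)

lemma trB_in_PTSalpha: "is_ptsc_tm arT arL M \<Longrightarrow> trB M \<in> PTSalpha arT arL"
  by (simp add: PTSalpha_def trB_res_ok)

lemma strip_papps_head: "strip_papps t us = (h, ts) \<Longrightarrow> h \<noteq> PApp u v"
  by (induction t us rule: strip_papps.induct) auto

lemma res_ok_NoView:
  assumes "res_ok arT arL 0 (PApp u v)" and "mv_view arT arL (PApp u v) = NoView"
  shows "res_ok arT arL 0 u"
proof -
  obtain h us where h: "strip_papps u [] = (h, us)" by fastforce
  then have u: "u = papps h us" using strip_papps_eq[OF h] by simp
  have nT: "PApp u v \<noteq> papps (PVar (ResT a)) ts" if "length ts = arT a" for a ts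
    using assms(2) that mv_view_ViewT_iff[of arT arL "PApp u v" a ts] by auto
  have nL: "PApp u v \<noteq> papps (PVar (ResL b)) (t # ts)" if "length ts = arL b" for b t ts
    using assms(2) that mv_view_ViewL_iff[of arT arL "PApp u v" b t ts] by auto
  have ok: "res_ok arT arL (Suc (length us)) h" "\<forall>w\<in>set us. res_ok arT arL 0 w"
    using assms(1) by (simp_all add: u res_ok_papps)
  have "res_ok arT arL (length us) h"
  proof (cases h)
    case (PVar x)
    show ?thesis
    proof (cases x)
      case (ResT a)
      then have "length us + 1 \<noteq> arT a" using nT[of "us @ [v]" a] PVar u by auto
      then show ?thesis using ok PVar ResT by simp
    next
      case (ResL b)
      have "length us \<noteq> arL b"
      proof
        assume l: "length us = arL b"
        obtain w ws where w: "us @ [v] = w # ws" by (cases "us @ [v]") auto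
        then have "length ws = arL b" using l by (metis length_append_singleton length_Cons nat.inject)
        then have "PApp u v \<noteq> papps h (us @ [v])" using nL w PVar ResL by metis
        then show False by (simp add: u)
      qed
      then show ?thesis using ok PVar ResL by simp
    qed (use PVar in simp)
  qed (use ok strip_papps_head[OF h] in auto)
  then show ?thesis using ok by (simp add: u res_ok_papps)
qed

lemma trA_is_ptsc_tm:
  fixes t t' :: "'s pts"
  shows "res_ok arT arL 0 t \<Longrightarrow> is_ptsc_tm arT arL (trA arT arL t)"
    and "res_ok arT' arL' 0 t' \<Longrightarrow> is_ptsc_tl arT' arL' l \<Longrightarrow>
      is_ptsc_tm arT' arL' (trAl arT' arL' l t')"
proof (induction arT arL t and arT' arL' l t' rule: trA_trAl.induct)
  case (1 arT arL t)
  show ?case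
  proof (cases "mv_view arT arL t")
    case (ViewT a ts)
    then have "\<forall>u\<in>set ts. res_ok arT arL 0 u" "length ts = arT a"
      using "1.prems" by (auto simp: mv_view_ViewT_iff res_ok_papps)
    then show ?thesis using ViewT 1
      by (subst trA.simps) (auto split: pts.splits)
  next
    case (ViewL b u ts)
    then have "\<forall>u\<in>set ts. res_ok arT arL 0 u" "length ts = arL b" "res_ok arT arL 0 u"
      using "1.prems" by (auto simp: mv_view_ViewL_iff res_ok_papps)
    then show ?thesis using ViewL 1
      by (subst trA.simps) (auto split: pts.splits)
  next
    case NoView
    then show ?thesis using 1 by (subst trA.simps) (auto split: pts.splits)
  qed
next
  case (2 arT arL l t)
  show ?case
  proof (cases "mv_view arT arL t")
    case (ViewT a ts)
    then have "\<forall>u\<in>set ts. res_ok arT arL 0 u" "length ts = arT a"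
      using "2.prems" by (auto simp: mv_view_ViewT_iff res_ok_papps)
    then show ?thesis using ViewT 2
      by (subst trAl.simps) (auto split: pts.splits)
  next
    case (ViewL b u ts)
    then have "\<forall>u\<in>set ts. res_ok arT arL 0 u" "length ts = arL b" "res_ok arT arL 0 u"
      using "2.prems" by (auto simp: mv_view_ViewL_iff res_ok_papps)
    then show ?thesis using ViewL 2
      by (subst trAl.simps) (auto split: pts.splits)
  next
    case NoView
    have "t \<noteq> PVar (ResT a)" "t \<noteq> PVar (ResL a)" for a
      using NoView "2.prems" mv_view_ViewT_iff[of arT arL t a "[]"] by auto
    moreover have "res_ok arT arL 0 u" if "t = PApp u v" for u v
      using res_ok_NoView[of arT arL u v] NoView "2.prems"(1) unfolding that by blast
    ultimately show ?thesis using NoView 2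
      by (subst trAl.simps) (auto split: pts.splits ptsvar.splits)
  qed
qed

lemma trA_PTSalpha: "t \<in> PTSalpha arT arL \<Longrightarrow> is_ptsc_tm arT arL (trA arT arL t)"
  by (simp add: PTSalpha_def trA_is_ptsc_tm)

end

theory Submission
  imports Defs
begin

text \<open>
  A list \<open>l\<close> acts on a PTS term \<open>t\<close> by \<open>\<B>\<^sup>z(l){z := t}\<close>, and this action is given by a sequence of
  arguments: ordinary ones, which turn \<open>t\<close> into \<open>t u\<close>, and list meta-variables, which turn \<open>t\<close> into
  \<open>\<beta>\<^sup>k t u\<^sub>1 \<dots> u\<^sub>k\<close>.  This sequence also describes the \<open>x'\<close>-normal form of \<open>l\<close>.  Part (1) follows
  by computing \<open>\<B>(\<A>\<^sub>l(t))\<close> as the action of \<open>l\<close> on \<open>t\<close>.  For part (2), \<open>x'\<close> simulates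
  application, \<open>\<A>(t) l \<rightarrow>\<^sup>* \<A>\<^sub>l(t)\<close>, and substitution,
  \<open>\<langle>\<A>(u)/x\<rangle>\<A>(t) \<rightarrow>\<^sup>* \<A>(t{x := u})\<close>; both parts of an explicit substitution are normalised before it
  is propagated, since \<open>x'\<close> has no rule for composing substitutions.
\<close>

section \<open>Renaming and substitution\<close>

lemma up_ren_simps [simp]: "up_ren f 0 = 0" "up_ren f (Suc n) = Suc (f n)"
  by (simp_all add: up_ren_def)

lemma up_sub_simps [simp]:
  "up_sub \<sigma> 0 = PVar (Ord 0)" "up_sub \<sigma> (Suc n) = ren_pts Suc (\<sigma> n)"
  by (simp_all add: up_sub_def)

lemma up_ren_comp: "up_ren f \<circ> up_ren g = up_ren (f \<circ> g)"
  by (rule ext) (simp add: up_ren_def split: nat.split)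

lemma ren_ren:
  fixes M :: "'s tm" and l :: "'s tl"
  shows "ren_tm f (ren_tm g M) = ren_tm (f \<circ> g) M"
    and "ren_tl f (ren_tl h l) = ren_tl (f \<circ> h) l"
  by (induction g M and h l arbitrary: f and f rule: ren_tm_ren_tl.induct)
    (simp_all add: up_ren_comp)

lemma ren_pts_ren_pts: "ren_pts f (ren_pts g t) = ren_pts (f \<circ> g) t"
  by (induction g t arbitrary: f rule: ren_pts.induct) (simp_all add: up_ren_comp)

lemma up_sub_comp_up_ren: "up_sub \<sigma> \<circ> up_ren f = up_sub (\<sigma> \<circ> f)"
  by (rule ext) (simp add: up_ren_def split: nat.split)

lemma sub_pts_ren_pts: "sub_pts \<sigma> (ren_pts f t) = sub_pts (\<sigma> \<circ> f) t"
  by (induction f t arbitrary: \<sigma> rule: ren_pts.induct) (simp_all add: up_sub_comp_up_ren)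

lemma ren_up_sub: "ren_pts (up_ren f) \<circ> up_sub \<sigma> = up_sub (ren_pts f \<circ> \<sigma>)"
proof
  fix n show "(ren_pts (up_ren f) \<circ> up_sub \<sigma>) n = up_sub (ren_pts f \<circ> \<sigma>) n"
    by (cases n) (simp_all add: ren_pts_ren_pts comp_def)
qed

lemma ren_pts_sub_pts: "ren_pts f (sub_pts \<sigma> t) = sub_pts (ren_pts f \<circ> \<sigma>) t"
  by (induction \<sigma> t arbitrary: f rule: sub_pts.induct) (simp_all add: ren_up_sub)

lemma up_sub_id: "up_sub (\<lambda>n. PVar (Ord n)) = (\<lambda>n. PVar (Ord n))"
  by (rule ext) (simp add: up_sub_def split: nat.split)

lemma sub_pts_id: "sub_pts (\<lambda>n. PVar (Ord n)) t = t"
proof (induction t)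
  case (PVar x)
  then show ?case by (cases x) simp_all
qed (simp_all add: up_sub_id)

lemma ren_pts_id [simp]: "ren_pts (\<lambda>n. n) t = t"
  using sub_pts_ren_pts[of "\<lambda>n. PVar (Ord n)" "\<lambda>n. n" t] by (simp add: comp_def sub_pts_id)

lemma pinst_simps [simp]:
  "pinst u (PVar (Ord 0)) = u"
  "pinst u (PVar (Ord (Suc n))) = PVar (Ord n)"
  "pinst u (PVar (ResT a)) = PVar (ResT a)"
  "pinst u (PVar (ResL a)) = PVar (ResL a)"
  "pinst u (PSort s) = PSort s"
  "pinst u (PApp t v) = PApp (pinst u t) (pinst u v)"
  by (simp_all add: pinst_def)

lemma pinst_lift [simp]: "pinst u (ren_pts Suc t) = t"
  by (simp add: pinst_def sub_pts_ren_pts comp_def sub_pts_id)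

text \<open>Unfolding \<open>comp_def\<close> merges a weakening with the renaming before it and
  hides the pattern of \<open>pinst_lift\<close>; this variant matches the merged form.\<close>

lemma pinst_lift_ren [simp]: "pinst u (ren_pts (\<lambda>n. Suc (f n)) t) = ren_pts f t"
  using pinst_lift[of u "ren_pts f t"] by (simp add: ren_pts_ren_pts comp_def del: pinst_lift)

lemma pinst_ren: "pinst (ren_pts f u) (ren_pts (up_ren f) t) = ren_pts f (pinst u t)"
proof -
  have "(\<lambda>n. case n of 0 \<Rightarrow> ren_pts f u | Suc m \<Rightarrow> PVar (Ord m)) \<circ> up_ren f =
      ren_pts f \<circ> (\<lambda>n. case n of 0 \<Rightarrow> u | Suc m \<Rightarrow> PVar (Ord m))"
    by (rule ext) (simp add: up_ren_def split: nat.split)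
  then show ?thesis by (simp add: pinst_def sub_pts_ren_pts ren_pts_sub_pts)
qed

text \<open>The PTS counterpart of the index manipulation in the rules \<open>C1\<close> and \<open>C5\<close>.\<close>

lemma pinst_under_binder:
  "sub_pts (up_sub (\<lambda>n. case n of 0 \<Rightarrow> u | Suc m \<Rightarrow> PVar (Ord m))) t =
    pinst (ren_pts Suc u) (ren_pts (id(0 := 1, 1 := 0)) t)"
proof -
  have "up_sub (\<lambda>n. case n of 0 \<Rightarrow> u | Suc m \<Rightarrow> PVar (Ord m)) =
      (\<lambda>n. case n of 0 \<Rightarrow> ren_pts Suc u | Suc m \<Rightarrow> PVar (Ord m)) \<circ> id(0 := 1, 1 := 0)"
    by (rule ext) (auto simp: up_sub_def split: nat.split)
  then show ?thesis by (simp only: pinst_def sub_pts_ren_pts)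
qed

lemma pinst_binders:
  "pinst u (PPi T U) =
    PPi (pinst u T) (pinst (ren_pts Suc u) (ren_pts (id(0 := 1, 1 := 0)) U))"
  "pinst u (PLam T t) =
    PLam (pinst u T) (pinst (ren_pts Suc u) (ren_pts (id(0 := 1, 1 := 0)) t))"
  by (simp_all only: pinst_under_binder[symmetric]) (simp_all add: pinst_def)

lemma ren_papps [simp]: "ren_pts f (papps t ts) = papps (ren_pts f t) (map (ren_pts f) ts)"
  by (induction ts arbitrary: t) simp_all

lemma pinst_papps [simp]: "pinst u (papps t ts) = papps (pinst u t) (map (pinst u) ts)"
  by (induction ts arbitrary: t) simp_all

section \<open>PTS\<open>\<alpha>\<close> terms, inductively\<close>

text \<open>For an application, \<open>res_ok\<close> at 0 asks for \<open>res_ok\<close> at 1 of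
  the function part, which may lie outside PTSalpha. Here a reserved variable only enters with its
  full list of arguments, so rule induction stays inside PTSalpha and follows the clauses of
  \<open>trA\<close>.\<close>

inductive ptsa :: "(nat \<Rightarrow> nat) \<Rightarrow> (nat \<Rightarrow> nat) \<Rightarrow> 's pts \<Rightarrow> bool"
  for arT arL :: "nat \<Rightarrow> nat" where
  var: "ptsa arT arL (PVar (Ord x))"
| sort: "ptsa arT arL (PSort s)"
| pi: "ptsa arT arL T \<Longrightarrow> ptsa arT arL U \<Longrightarrow> ptsa arT arL (PPi T U)"
| lam: "ptsa arT arL T \<Longrightarrow> ptsa arT arL t \<Longrightarrow> ptsa arT arL (PLam T t)"
| metaT: "length ts = arT a \<Longrightarrow> \<forall>t\<in>set ts. ptsa arT arL t \<Longrightarrow>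
    ptsa arT arL (papps (PVar (ResT a)) ts)"
| metaL: "length ts = arL b \<Longrightarrow> ptsa arT arL t \<Longrightarrow> \<forall>t\<in>set ts. ptsa arT arL t \<Longrightarrow>
    ptsa arT arL (papps (PApp (PVar (ResL b)) t) ts)"
| app: "ptsa arT arL t \<Longrightarrow> ptsa arT arL u \<Longrightarrow> ptsa arT arL (PApp t u)"

lemma ptsa_res_ok: "ptsa arT arL t \<Longrightarrow> res_ok arT arL 0 t"
  by (induction rule: ptsa.induct) (auto simp: res_ok_papps intro: res_ok_mono)

text \<open>Induction on size, since a view strips all arguments of a reserved variable at once. An
  application without a view has its function part in PTSalpha by
  \<open>res_ok_NoView\<close>.\<close>

lemma res_ok_ptsa: "res_ok arT arL 0 t \<Longrightarrow> ptsa arT arL t"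
proof (induction t rule: measure_induct_rule[of nodes_pts])
  case (less t)
  show ?case
  proof (cases "mv_view arT arL t")
    case (ViewT a ts)
    then have t: "t = papps (PVar (ResT a)) ts" "length ts = arT a"
      by (simp_all add: mv_view_ViewT_iff)
    moreover have "ptsa arT arL u" if "u \<in> set ts" for u
      using that less mv_view_ViewT_less[OF ViewT] t by (auto simp: res_ok_papps)
    ultimately show ?thesis by (auto intro: ptsa.metaT)
  next
    case (ViewL b v ts)
    then have t: "t = papps (PApp (PVar (ResL b)) v) ts" "length ts = arL b"
      by (simp_all add: mv_view_ViewL_iff)
    moreover have "ptsa arT arL u" if "u \<in> insert v (set ts)" for u
      using that less mv_view_ViewL_less[OF ViewL] t by (auto simp: res_ok_papps)
    ultimately show ?thesis by (auto intro: ptsa.metaL)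
  next
    case NoView
    show ?thesis
    proof (cases t)
      case (PVar x)
      show ?thesis
      proof (cases x)
        case (ResT a)
        then show ?thesis
          using PVar less.prems NoView mv_view_ViewT_iff[of arT arL t a "[]"] by auto
      qed (use PVar less.prems in \<open>auto intro: ptsa.var\<close>)
    next
      case (PApp u v)
      moreover have "res_ok arT arL 0 u"
        using res_ok_NoView less.prems NoView PApp by blast
      ultimately show ?thesis using less by (auto intro: ptsa.app)
    qed (use less in \<open>auto intro: ptsa.intros\<close>)
  qed
qed

lemma ptsa_iff: "ptsa arT arL t \<longleftrightarrow> res_ok arT arL 0 t"
  using ptsa_res_ok res_ok_ptsa by blast

lemma ptsa_ren: "ptsa arT arL t \<Longrightarrow> ptsa arT arL (ren_pts f t)"
  by (simp add: ptsa_iff res_ok_ren)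

lemma ptsa_pinst: "ptsa arT arL u \<Longrightarrow> ptsa arT arL t \<Longrightarrow> ptsa arT arL (pinst u t)"
  by (simp add: ptsa_iff res_ok_pinst)

text \<open>In \<open>t u\<close> with \<open>t\<close> in PTS\<open>\<alpha>\<close>, a reserved head already has all its arguments in \<open>t\<close>.\<close>

lemma mv_view_PApp:
  assumes "ptsa arT arL t" shows "mv_view arT arL (PApp t u) = NoView"
proof -
  have ok: "res_ok arT arL 0 t" using assms by (rule ptsa_res_ok)
  show ?thesis
  proof (cases "mv_view arT arL (PApp t u)")
    case (ViewT a ts)
    then have "PApp t u = papps (PVar (ResT a)) ts" "length ts = arT a"
      by (simp_all add: mv_view_ViewT_iff)
    then show ?thesis
      using ok by (cases ts rule: rev_cases) (auto simp: res_ok_papps)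
  next
    case (ViewL b v ts)
    then have "PApp t u = papps (PApp (PVar (ResL b)) v) ts" "length ts = arL b"
      by (simp_all add: mv_view_ViewL_iff)
    then show ?thesis
      using ok by (cases ts rule: rev_cases) (auto simp: res_ok_papps)
  qed simp
qed

lemma trA_simps [simp]:
  "trA arT arL (PVar (Ord x)) = TVar x LNil"
  "trA arT arL (PSort s) = TSort s"
  "trA arT arL (PPi T U) = TPi (trA arT arL T) (trA arT arL U)"
  "trA arT arL (PLam T t) = TLam (trA arT arL T) (trA arT arL t)"
  "length ts = arT a \<Longrightarrow>
    trA arT arL (papps (PVar (ResT a)) ts) = TMeta a (map (trA arT arL) ts)"
  "length ts = arL b \<Longrightarrow>
    trA arT arL (papps (PApp (PVar (ResL b)) t) ts) =
      trAl arT arL (LMeta b (map (trA arT arL) ts)) t"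
  "ptsa arT arL t \<Longrightarrow>
    trA arT arL (PApp t u) = trAl arT arL (LCons (trA arT arL u) LNil) t"
  \<comment> \<open>As an inserted fact this equation is simplified too, which turns its argument
    list \<open>t # ts\<close> into the form of the goal.\<close>
  using trA_eqs(5)[of ts arL b arT t]
  by (simp_all add: trA_eqs trAl_eqs mv_view_PApp)

lemma trAl_simps [simp]:
  "trAl arT arL l (PVar (Ord x)) = TVar x l"
  "trAl arT arL l (PSort s) = TApp (TSort s) l"
  "trAl arT arL l (PPi T U) = TApp (TPi (trA arT arL T) (trA arT arL U)) l"
  "trAl arT arL l (PLam T v) = TApp (TLam (trA arT arL T) (trA arT arL v)) l"
  "length ts = arT a \<Longrightarrow>
    trAl arT arL l (papps (PVar (ResT a)) ts) = TApp (TMeta a (map (trA arT arL) ts)) l"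
  "length ts = arL b \<Longrightarrow>
    trAl arT arL l (papps (PApp (PVar (ResL b)) t) ts) =
      trAl arT arL (LCat (LMeta b (map (trA arT arL) ts)) l) t"
  "ptsa arT arL t \<Longrightarrow>
    trAl arT arL l (PApp t u) = trAl arT arL (LCons (trA arT arL u) l) t"
  using trAl_eqs(2)[of ts arL b arT l t]
  by (simp_all add: trAl_eqs mv_view_PApp)

lemma trA_ren_both:
  assumes "ptsa arT arL t"
  shows "trA arT arL (ren_pts f t) = ren_tm f (trA arT arL t) \<and>
    (\<forall>l. trAl arT arL (ren_tl f l) (ren_pts f t) = ren_tm f (trAl arT arL l t))"
  using assms
proof (induction arbitrary: f rule: ptsa.induct)
  case (metaL ts b t)
  then have "map (trA arT arL \<circ> ren_pts f) ts = map (ren_tm f \<circ> trA arT arL) ts" by simp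
  \<comment> \<open>The induction hypothesis expects an accumulator of the form
    \<open>ren_tl f l\<close>, so the renamed list is folded back into that form.\<close>
  then have *: "LMeta b (map (trA arT arL \<circ> ren_pts f) ts) =
      ren_tl f (LMeta b (map (trA arT arL) ts))" by simp
  then have "LCat (LMeta b (map (trA arT arL \<circ> ren_pts f) ts)) (ren_tl f l) =
      ren_tl f (LCat (LMeta b (map (trA arT arL) ts)) l)" for l by simp
  with * metaL show ?case
    by (simp del: ren_tl.simps)
next
  case (app t u)
  have "LCons (ren_tm f (trA arT arL u)) (ren_tl f l) = ren_tl f (LCons (trA arT arL u) l)" for l
    by simp
  moreover have "LCons (ren_tm f (trA arT arL u)) LNil = ren_tl f (LCons (trA arT arL u) LNil)"
    by simp
  ultimately show ?case using app by (simp add: ptsa_ren del: ren_tl.simps)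
qed simp_all

lemma trA_ren: "ptsa arT arL t \<Longrightarrow> trA arT arL (ren_pts f t) = ren_tm f (trA arT arL t)"
  by (simp add: trA_ren_both)

section \<open>Lists as sequences of arguments\<close>

text \<open>The type parameter provides \<open>map_arg\<close>, through which renamings and
  substitutions act on arguments.\<close>

datatype 'p arg = Arg 'p | MArg nat "'p list"

fun extend :: "'s pts \<Rightarrow> 's pts arg \<Rightarrow> 's pts" where
  "extend t (Arg u) = PApp t u"
| "extend t (MArg b ts) = papps (PApp (PVar (ResL b)) t) ts"

abbreviation extends :: "'s pts \<Rightarrow> 's pts arg list \<Rightarrow> 's pts" where
  "extends \<equiv> foldl extend"

fun spine :: "'s tl \<Rightarrow> 's pts arg list" where
  "spine LNil = []"
| "spine (LCons M l) = Arg (trB M) # spine l"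
| "spine (LCat l l') = spine l @ spine l'"
| "spine (LSub P K l) = map (map_arg (pinst (trB P))) (spine l)"
| "spine (LMeta b Ms) = [MArg b (map trB Ms)]"

lemma extend_ren: "ren_pts f (extend t i) = extend (ren_pts f t) (map_arg (ren_pts f) i)"
  by (cases i) simp_all

lemma extend_pinst: "pinst u (extend t i) = extend (pinst u t) (map_arg (pinst u) i)"
  by (cases i) simp_all

lemma extends_ren:
  "ren_pts f (extends t is) = extends (ren_pts f t) (map (map_arg (ren_pts f)) is)"
  by (induction "is" arbitrary: t) (simp_all add: extend_ren)

lemma extends_pinst:
  "pinst u (extends t is) = extends (pinst u t) (map (map_arg (pinst u)) is)"
  by (induction "is" arbitrary: t) (simp_all add: extend_pinst)

text \<open>The clauses of \<open>trBl\<close> recurse on weakened lists, so a structural induction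
  has to cover all renamings of \<open>l\<close>.\<close>

lemma trB_ren_spine:
  fixes M :: "'s tm" and l :: "'s tl"
  shows "\<forall>f. trB (ren_tm f M) = ren_pts f (trB M)"
    and "\<forall>f. spine (ren_tl f l) = map (map_arg (ren_pts f)) (spine l) \<and>
      (\<forall>y. trBl y (ren_tl f l) = extends (PVar (Ord y)) (map (map_arg (ren_pts f)) (spine l)))"
  by (induction M and l)
    (simp_all add: ren_ren extends_ren pinst_ren extends_pinst arg.map_comp comp_def cong: map_cong)

text \<open>Weakening by the fresh \<open>z\<close> and then instantiating \<open>z\<close> cancel
  on every argument.\<close>

lemma trB_spine [simp]:
  "trB (TVar x l) = extends (PVar (Ord x)) (spine l)"
  "trB (TApp M l) = extends (trB M) (spine l)"
  by (simp_all add: trB_ren_spine extends_pinst arg.map_comp comp_def arg.map_ident)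

declare trB.simps(4,5) [simp del]

text \<open>Each recursive clause of \<open>trAl\<close> moves the last argument of \<open>t\<close>
  to the front of the accumulator, and \<open>extends\<close> moves it back.\<close>

lemma trB_trA_both:
  assumes "ptsa arT arL t"
  shows "trB (trA arT arL t) = t \<and> (\<forall>l. trB (trAl arT arL l t) = extends t (spine l))"
  using assms
  by (induction rule: ptsa.induct) (simp_all add: comp_def cong: map_cong)

lemma trB_trA: "t \<in> PTSalpha arT arL \<Longrightarrow> trB (trA arT arL t) = t"
  by (simp add: PTSalpha_def trB_trA_both ptsa_iff)

section \<open>Reductions\<close>

abbreviation reds_tm :: "'s tm \<Rightarrow> 's tm \<Rightarrow> bool" where
  "reds_tm \<equiv> red_tm\<^sup>*\<^sup>*"

abbreviation reds_tl :: "'s tl \<Rightarrow> 's tl \<Rightarrow> bool" where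
  "reds_tl \<equiv> red_tl\<^sup>*\<^sup>*"

lemma rtranclp_cong1:
  assumes "\<And>x y. r x y \<Longrightarrow> s (F x) (F y)" and "r\<^sup>*\<^sup>* x y"
  shows "s\<^sup>*\<^sup>* (F x) (F y)"
  using assms(2) by (induction) (auto intro: assms(1) rtranclp.rtrancl_into_rtrancl)

lemma rtranclp_cong2:
  assumes "\<And>x y z. r x y \<Longrightarrow> s (F x z) (F y z)" and "\<And>x y z. q x y \<Longrightarrow> s (F z x) (F z y)"
    and "r\<^sup>*\<^sup>* x x'" and "q\<^sup>*\<^sup>* y y'"
  shows "s\<^sup>*\<^sup>* (F x y) (F x' y')"
  using rtranclp_cong1[of r s "\<lambda>x. F x y", OF assms(1,3)]
    rtranclp_cong1[of q s "F x'", OF assms(2,4)] by (rule rtranclp_trans)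

lemma rtranclp_cong_list:
  assumes "\<And>xs x y ys. r x y \<Longrightarrow> s (F (xs @ x # ys)) (F (xs @ y # ys))"
    and "list_all2 r\<^sup>*\<^sup>* xs ys"
  shows "s\<^sup>*\<^sup>* (F xs) (F ys)"
proof -
  \<comment> \<open>The prefix \<open>zs\<close> collects the entries that have already been
    reduced.\<close>
  have "s\<^sup>*\<^sup>* (F (zs @ xs)) (F (zs @ ys))" for zs
    using assms(2)
  proof (induction xs ys arbitrary: zs rule: list_all2_induct)
    case (Cons x xs y ys)
    have "s\<^sup>*\<^sup>* (F (zs @ x # xs)) (F (zs @ y # xs))"
      using rtranclp_cong1[of r s "\<lambda>x. F (zs @ x # xs)"] assms(1) Cons(1) by blast
    also have "s\<^sup>*\<^sup>* (F (zs @ y # xs)) (F (zs @ y # ys))"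
      using Cons(3)[of "zs @ [y]"] by simp
    finally show ?case .
  qed simp
  from this[of "[]"] show ?thesis by simp
qed

text \<open>The annotation \<open>G\<close> of an explicit substitution stays fixed:
  \<open>trB\<close> discards it, so it need not be normalised.\<close>

lemma reds_congs:
  "reds_tm A A' \<Longrightarrow> reds_tm M M' \<Longrightarrow> reds_tm (TPi A M) (TPi A' M')"
  "reds_tm A A' \<Longrightarrow> reds_tm M M' \<Longrightarrow> reds_tm (TLam A M) (TLam A' M')"
  "reds_tl l l' \<Longrightarrow> reds_tm (TVar x l) (TVar x l')"
  "reds_tm M M' \<Longrightarrow> reds_tl l l' \<Longrightarrow> reds_tm (TApp M l) (TApp M' l')"
  "reds_tm A A' \<Longrightarrow> reds_tm M M' \<Longrightarrow> reds_tm (TSub A G M) (TSub A' G M')"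
  "reds_tm M M' \<Longrightarrow> reds_tl l l' \<Longrightarrow> reds_tl (LCons M l) (LCons M' l')"
  "reds_tl l l' \<Longrightarrow> reds_tl k k' \<Longrightarrow> reds_tl (LCat l k) (LCat l' k')"
  "reds_tm A A' \<Longrightarrow> reds_tl l l' \<Longrightarrow> reds_tl (LSub A G l) (LSub A' G l')"
  by (rule rtranclp_cong2 rtranclp_cong1, erule red_tm_red_tl.intros,
      (erule red_tm_red_tl.intros)?; assumption)+

lemma reds_meta:
  "list_all2 red_tm\<^sup>*\<^sup>* Ms Ns \<Longrightarrow> reds_tm (TMeta a Ms) (TMeta a Ns)"
  "list_all2 red_tm\<^sup>*\<^sup>* Ms Ns \<Longrightarrow> reds_tl (LMeta b Ms) (LMeta b Ns)"
  by (rule rtranclp_cong_list, erule red_tm_red_tl.intros, assumption)+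

lemmas red_intros =
  red_tm_red_tl.intros(1-3,8-14)[THEN r_into_rtranclp[of red_tm]]
  red_tm_red_tl.intros(4-7,15-18)[THEN r_into_rtranclp[of red_tl]]

text \<open>Without these instances, chains of reductions make \<open>also\<close> try the substitution rules, which is
  very slow.\<close>

lemmas reds_trans [trans] = rtranclp_trans[of red_tm] rtranclp_trans[of red_tl]

section \<open>Simulation of application\<close>

lemma trAl_cong:
  assumes "ptsa arT arL t" and "reds_tl l l'"
  shows "reds_tm (trAl arT arL l t) (trAl arT arL l' t)"
  using assms
  by (induction arbitrary: l l' rule: ptsa.induct) (auto intro: reds_congs)

text \<open>B2 or B3 merges the two lists at the head of \<open>t\<close>; A3 and A1 then restore
  the shape of the accumulator on the way back out.\<close>

lemma TApp_trAl:
  assumes "ptsa arT arL t"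
  shows "reds_tm (TApp (trAl arT arL l t) l') (trAl arT arL (LCat l l') t)"
  using assms
proof (induction arbitrary: l rule: ptsa.induct)
  case (metaL ts b t)
  have "reds_tm (TApp (trAl arT arL (LCat (LMeta b (map (trA arT arL) ts)) l) t) l')
      (trAl arT arL (LCat (LCat (LMeta b (map (trA arT arL) ts)) l) l') t)"
    by (rule metaL.IH)
  also have "reds_tm \<dots> (trAl arT arL (LCat (LMeta b (map (trA arT arL) ts)) (LCat l l')) t)"
    by (rule trAl_cong[OF metaL.hyps(2)]) (rule red_intros)
  finally show ?case using metaL.hyps by simp
next
  case (app t u)
  have "reds_tm (TApp (trAl arT arL (LCons (trA arT arL u) l) t) l')
      (trAl arT arL (LCat (LCons (trA arT arL u) l) l') t)"
    by (rule app.IH)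
  also have "reds_tm \<dots> (trAl arT arL (LCons (trA arT arL u) (LCat l l')) t)"
    by (rule trAl_cong[OF app.hyps(1)]) (rule red_intros)
  finally show ?case using app.hyps by simp
qed (simp_all add: red_intros)

lemma TApp_trA:
  assumes "ptsa arT arL t"
  shows "reds_tm (TApp (trA arT arL t) l) (trAl arT arL l t)"
  using assms
proof cases
  case (metaL ts b t)
  then show ?thesis by (simp add: TApp_trAl)
next
  case (app t u)
  have "reds_tm (TApp (trAl arT arL (LCons (trA arT arL u) LNil) t) l)
      (trAl arT arL (LCat (LCons (trA arT arL u) LNil) l) t)"
    by (rule TApp_trAl[OF app(2)])
  also have "reds_tm \<dots> (trAl arT arL (LCons (trA arT arL u) (LCat LNil l)) t)"
    by (rule trAl_cong[OF app(2)]) (rule red_intros)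
  also have "reds_tm \<dots> (trAl arT arL (LCons (trA arT arL u) l) t)"
    by (rule trAl_cong[OF app(2)], rule reds_congs) (rule red_intros rtranclp.rtrancl_refl)+
  finally show ?thesis using app by simp
next
  case (var x)
  have "reds_tm (TApp (TVar x LNil) l) (TVar x (LCat LNil l))" by (rule red_intros)
  also have "reds_tm \<dots> (TVar x l)" by (rule reds_congs, rule red_intros)
  finally show ?thesis using var by simp
qed simp_all

text \<open>The two sides differ only for a head applied to \<open>LNil\<close>, removed by B1, and
  for a list meta-variable followed by \<open>LNil\<close>, removed by A4.\<close>

lemma trAl_LNil:
  assumes "ptsa arT arL t"
  shows "reds_tm (trAl arT arL LNil t) (trA arT arL t)"
  using assms
proof cases
  case (metaL ts b t)
  then show ?thesis by (simp add: trAl_cong red_intros)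
qed (simp_all add: red_intros)

section \<open>Simulation of substitution\<close>

lemma TSub_TApp:
  assumes "reds_tm (TSub P G M) M'"
  shows "reds_tm (TSub P G (TApp M l)) (TApp M' (LSub P G l))"
proof -
  have "reds_tm (TSub P G (TApp M l)) (TApp (TSub P G M) (LSub P G l))" by (rule red_intros)
  also have "reds_tm \<dots> (TApp M' (LSub P G l))"
    by (intro reds_congs assms rtranclp.rtrancl_refl)
  finally show ?thesis .
qed

text \<open>Adapts the induction hypothesis to the contracta of C1 and C5: the index swap
  \<open>g\<close> is absorbed into the renaming of \<open>t\<close>, and the weakened translation
  of \<open>u\<close> is the translation of the weakened \<open>u\<close>.\<close>

lemma TSub_under_binder:
  assumes "\<And>f u G. ptsa arT arL u \<Longrightarrow>
      reds_tm (TSub (trA arT arL u) G (trA arT arL (ren_pts f t))) (trA arT arL (pinst u (ren_pts f t)))"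
    and "ptsa arT arL t" and "ptsa arT arL u"
  shows "reds_tm (TSub (lift_tm (trA arT arL u)) G (ren_tm g (trA arT arL (ren_pts f t))))
    (trA arT arL (pinst (ren_pts Suc u) (ren_pts g (ren_pts f t))))"
  using assms(1)[OF ptsa_ren[OF assms(3)], of Suc G "g \<circ> f"] assms(2,3)
  by (simp add: trA_ren ptsa_ren ren_ren ren_pts_ren_pts)

text \<open>
  Generalised over a renaming of \<open>t\<close>, because the propagation of an explicit substitution under a
  binder exchanges two indices in the body.
\<close>

lemma TSub_trA_ren:
  assumes "ptsa arT arL t" and "ptsa arT arL u"
  shows "reds_tm (TSub (trA arT arL u) G (trA arT arL (ren_pts f t)))
      (trA arT arL (pinst u (ren_pts f t))) \<and>
    (\<forall>l. reds_tm (TSub (trA arT arL u) G (trAl arT arL l (ren_pts f t)))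
      (trAl arT arL (LSub (trA arT arL u) G l) (pinst u (ren_pts f t))))"
  using assms
proof (induction arbitrary: f u G rule: ptsa.induct)
  case (var x)
  let ?u = "trA arT arL u"
  have l: "reds_tm (TSub ?u G (TVar (f x) l))
      (trAl arT arL (LSub ?u G l) (pinst u (PVar (Ord (f x)))))" for l
  proof (cases "f x")
    case 0
    have "reds_tm (TSub ?u G (TVar 0 l)) (TApp ?u (LSub ?u G l))" by (rule red_intros)
    also have "reds_tm \<dots> (trAl arT arL (LSub ?u G l) u)" by (intro TApp_trA var)
    finally show ?thesis using 0 by simp
  qed (simp_all add: red_intros)
  have p: "ptsa arT arL (pinst u (PVar (Ord (f x))))" by (intro ptsa_pinst var ptsa.var)
  \<comment> \<open>A variable is translated with the list \<open>LNil\<close>, so the first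
    conjunct follows from the second once D1 has erased the substitution on
    \<open>LNil\<close>.\<close>
  note l[of LNil]
  also have "reds_tm (trAl arT arL (LSub ?u G LNil) (pinst u (PVar (Ord (f x)))))
      (trAl arT arL LNil (pinst u (PVar (Ord (f x)))))"
    by (intro trAl_cong p red_intros)
  also have "reds_tm \<dots> (trA arT arL (pinst u (PVar (Ord (f x)))))"
    by (rule trAl_LNil[OF p])
  finally show ?case using l by simp
next
  case (sort s)
  show ?case by (simp add: red_intros TSub_TApp)
next
  case (pi T t)
  let ?u = "trA arT arL u"
  have "reds_tm (TSub ?u G (TPi (trA arT arL (ren_pts f T)) (trA arT arL (ren_pts (up_ren f) t))))
      (TPi (TSub ?u G (trA arT arL (ren_pts f T)))
        (TSub (lift_tm ?u) (lift_tm G) (swap_tm (trA arT arL (ren_pts (up_ren f) t)))))"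
    by (rule red_intros)
  also have "reds_tm \<dots> (TPi (trA arT arL (pinst u (ren_pts f T))) (trA arT arL
      (pinst (ren_pts Suc u) (ren_pts (id(0 := 1, 1 := 0)) (ren_pts (up_ren f) t)))))"
    by (intro reds_congs TSub_under_binder pi.hyps pi.prems pi.IH[THEN conjunct1])
  finally have "reds_tm (TSub ?u G (TPi (trA arT arL (ren_pts f T)) (trA arT arL (ren_pts (up_ren f) t))))
      (TPi (trA arT arL (pinst u (ren_pts f T))) (trA arT arL
        (pinst (ren_pts Suc u) (ren_pts (id(0 := 1, 1 := 0)) (ren_pts (up_ren f) t)))))" .
  then show ?case by (simp add: pinst_binders TSub_TApp)
next
  case (lam T t)
  let ?u = "trA arT arL u"
  have "reds_tm (TSub ?u G (TLam (trA arT arL (ren_pts f T)) (trA arT arL (ren_pts (up_ren f) t))))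
      (TLam (TSub ?u G (trA arT arL (ren_pts f T)))
        (TSub (lift_tm ?u) (lift_tm G) (swap_tm (trA arT arL (ren_pts (up_ren f) t)))))"
    by (rule red_intros)
  also have "reds_tm \<dots> (TLam (trA arT arL (pinst u (ren_pts f T))) (trA arT arL
      (pinst (ren_pts Suc u) (ren_pts (id(0 := 1, 1 := 0)) (ren_pts (up_ren f) t)))))"
    by (intro reds_congs TSub_under_binder lam.hyps lam.prems lam.IH[THEN conjunct1])
  finally have "reds_tm (TSub ?u G (TLam (trA arT arL (ren_pts f T)) (trA arT arL (ren_pts (up_ren f) t))))
      (TLam (trA arT arL (pinst u (ren_pts f T))) (trA arT arL
        (pinst (ren_pts Suc u) (ren_pts (id(0 := 1, 1 := 0)) (ren_pts (up_ren f) t)))))" .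
  then show ?case by (simp add: pinst_binders TSub_TApp)
next
  case (metaT ts a)
  let ?u = "trA arT arL u" and ?ts = "map (trA arT arL \<circ> ren_pts f) ts"
  have "reds_tm (TSub ?u G (TMeta a ?ts)) (TMeta a (map (TSub ?u G) ?ts))"
    by (rule red_intros)
  also have "reds_tm \<dots> (TMeta a (map (trA arT arL \<circ> pinst u \<circ> ren_pts f) ts))"
    using metaT by (intro reds_meta) (auto simp: list_all2_conv_all_nth)
  finally show ?case using metaT.hyps by (simp add: comp_def TSub_TApp)
next
  case (metaL ts b t)
  let ?u = "trA arT arL u" and ?ts = "map (trA arT arL \<circ> ren_pts f) ts"
  let ?vs = "map (trA arT arL \<circ> pinst u \<circ> ren_pts f) ts"
  let ?t = "pinst u (ren_pts f t)"
  have p: "ptsa arT arL ?t" using metaL by (intro ptsa_pinst ptsa_ren)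
  have "reds_tl (LSub ?u G (LMeta b ?ts)) (LMeta b (map (TSub ?u G) ?ts))"
    by (rule red_intros)
  also have "reds_tl \<dots> (LMeta b ?vs)"
    using metaL by (intro reds_meta) (auto simp: list_all2_conv_all_nth)
  finally have 1: "reds_tl (LSub ?u G (LMeta b ?ts)) (LMeta b ?vs)" .
  have IH: "reds_tm (TSub ?u G (trAl arT arL l (ren_pts f t))) (trAl arT arL (LSub ?u G l) ?t)" for l
    using metaL by blast
  have "reds_tm (TSub ?u G (trAl arT arL (LMeta b ?ts) (ren_pts f t))) (trAl arT arL (LMeta b ?vs) ?t)"
    using IH trAl_cong[OF p 1] by (rule rtranclp_trans)
  moreover have "reds_tl (LSub ?u G (LCat (LMeta b ?ts) l))
      (LCat (LSub ?u G (LMeta b ?ts)) (LSub ?u G l))" for l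
    by (rule red_intros)
  \<comment> \<open>After D3 only the meta-variable is substituted into; the substitution on
    \<open>l\<close> stays pending, as the second conjunct demands.\<close>
  then have "reds_tl (LSub ?u G (LCat (LMeta b ?ts) l)) (LCat (LMeta b ?vs) (LSub ?u G l))" for l
    by (rule rtranclp_trans) (intro reds_congs 1 rtranclp.rtrancl_refl)
  then have "reds_tm (TSub ?u G (trAl arT arL (LCat (LMeta b ?ts) l) (ren_pts f t)))
      (trAl arT arL (LCat (LMeta b ?vs) (LSub ?u G l)) ?t)" for l
    using IH trAl_cong[OF p] by (meson rtranclp_trans)
  ultimately show ?case using metaL.hyps by (simp add: comp_def)
next
  case (app t v)
  let ?u = "trA arT arL u" and ?v = "trA arT arL (ren_pts f v)"
  let ?t = "pinst u (ren_pts f t)" and ?w = "trA arT arL (pinst u (ren_pts f v))"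
  have p: "ptsa arT arL ?t" using app by (intro ptsa_pinst ptsa_ren)
  have 1: "reds_tl (LSub ?u G (LCons ?v l)) (LCons ?w l')" if "reds_tl (LSub ?u G l) l'" for l l'
  proof -
    have "reds_tl (LSub ?u G (LCons ?v l)) (LCons (TSub ?u G ?v) (LSub ?u G l))"
      by (rule red_intros)
    also have "reds_tl \<dots> (LCons ?w l')"
      using app that by (intro reds_congs) auto
    finally show ?thesis .
  qed
  have "reds_tm (TSub ?u G (trAl arT arL (LCons ?v l) (ren_pts f t))) (trAl arT arL (LCons ?w l') ?t)"
    if "reds_tl (LSub ?u G l) l'" for l l'
  proof -
    have "reds_tm (TSub ?u G (trAl arT arL (LCons ?v l) (ren_pts f t)))
        (trAl arT arL (LSub ?u G (LCons ?v l)) ?t)"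
      using app by blast
    then show ?thesis using trAl_cong[OF p 1[OF that]] by (rule rtranclp_trans)
  qed
  \<comment> \<open>The first instance, with D1 for its premise, gives the first conjunct; the
    second leaves the substitution on \<open>l\<close> pending and gives the other one.\<close>
  from this[of LNil LNil] this[of l "LSub ?u G l" for l] show ?case
    using app.hyps p by (simp add: ptsa_ren red_intros)
qed

lemma TSub_trA:
  assumes "ptsa arT arL t" and "ptsa arT arL u"
  shows "reds_tm (TSub (trA arT arL u) G (trA arT arL t)) (trA arT arL (pinst u t))"
  using TSub_trA_ren[OF assms, of G "\<lambda>n. n"] by simp

section \<open>Normal forms of lists\<close>

text \<open>
  The list \<open>\<beta>(M\<^sub>1, \<dots>, M\<^sub>n)\<close> does not reduce to \<open>\<beta>(M\<^sub>1, \<dots>, M\<^sub>n) @ []\<close>, hence the separate case of a final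
  list meta-variable.
\<close>

fun list_of :: "(nat \<Rightarrow> nat) \<Rightarrow> (nat \<Rightarrow> nat) \<Rightarrow> 's pts arg list \<Rightarrow> 's tl" where
  "list_of arT arL [] = LNil"
| "list_of arT arL (Arg u # is) = LCons (trA arT arL u) (list_of arT arL is)"
| "list_of arT arL [MArg b ts] = LMeta b (map (trA arT arL) ts)"
| "list_of arT arL (MArg b ts # i # is) =
    LCat (LMeta b (map (trA arT arL) ts)) (list_of arT arL (i # is))"

fun arg_ok :: "(nat \<Rightarrow> nat) \<Rightarrow> (nat \<Rightarrow> nat) \<Rightarrow> 's pts arg \<Rightarrow> bool" where
  "arg_ok arT arL (Arg u) = ptsa arT arL u"
| "arg_ok arT arL (MArg b ts) = (length ts = arL b \<and> (\<forall>t\<in>set ts. ptsa arT arL t))"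

lemma ptsa_trB: "is_ptsc_tm arT arL M \<Longrightarrow> ptsa arT arL (trB M)"
  by (simp add: ptsa_iff trB_res_ok)

lemma arg_ok_pinst:
  "arg_ok arT arL i \<Longrightarrow> ptsa arT arL u \<Longrightarrow> arg_ok arT arL (map_arg (pinst u) i)"
  by (cases i) (auto intro: ptsa_pinst)

lemma spine_ok: "is_ptsc_tl arT arL l \<Longrightarrow> \<forall>i\<in>set (spine l). arg_ok arT arL i"
  by (induction l rule: spine.induct) (auto simp: ptsa_trB intro: arg_ok_pinst)

text \<open>Read from right to left, the clauses of \<open>trAl\<close> move the arguments one by
  one from the list into the term. Only an exhausted list requires a reduction, by
  \<open>trAl_LNil\<close>.\<close>

lemma trAl_list_of:
  "\<forall>i\<in>set is. arg_ok arT arL i \<Longrightarrow> ptsa arT arL t \<Longrightarrow>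
    reds_tm (trAl arT arL (list_of arT arL is) t) (trA arT arL (extends t is))"
proof (induction arT arL "is" arbitrary: t rule: list_of.induct)
  case (2 arT arL u "is")
  then show ?case using "2.IH"[of "PApp t u"] by (auto intro: ptsa.app)
next
  case (4 arT arL b ts i "is")
  then have "ptsa arT arL (papps (PApp (PVar (ResL b)) t) ts)" by (auto intro: ptsa.metaL)
  from "4.IH"[OF _ this] "4.prems" show ?case by simp
qed (auto intro: trAl_LNil)

lemma LCat_list_of:
  "reds_tl (LCat (list_of arT arL is) (list_of arT arL js)) (list_of arT arL (is @ js))"
proof (induction arT arL "is" rule: list_of.induct)
  case (2 arT arL u "is")
  have "reds_tl (LCat (LCons (trA arT arL u) (list_of arT arL is)) (list_of arT arL js))
      (LCons (trA arT arL u) (LCat (list_of arT arL is) (list_of arT arL js)))"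
    by (rule red_intros)
  also have "reds_tl \<dots> (LCons (trA arT arL u) (list_of arT arL (is @ js)))"
    by (intro reds_congs 2 rtranclp.rtrancl_refl)
  finally show ?case by simp
next
  case (3 arT arL b ts)
  \<comment> \<open>For empty \<open>js\<close>, A4 is needed; otherwise both sides are
    equal.\<close>
  then show ?case by (cases js) (simp_all add: red_intros)
next
  case (4 arT arL b ts i "is")
  let ?b = "LMeta b (map (trA arT arL) ts)"
  have "reds_tl (LCat (LCat ?b (list_of arT arL (i # is))) (list_of arT arL js))
      (LCat ?b (LCat (list_of arT arL (i # is)) (list_of arT arL js)))"
    by (rule red_intros)
  also have "reds_tl \<dots> (LCat ?b (list_of arT arL ((i # is) @ js)))"
    by (intro reds_congs 4 rtranclp.rtrancl_refl)
  finally show ?case by simp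
qed (simp_all add: red_intros)

text \<open>D1, D2, D3 and Dbeta carry the substitution to the arguments. These are images of
  \<open>trA\<close>, so \<open>TSub_trA\<close> applies to them.\<close>

lemma LSub_list_of:
  assumes "ptsa arT arL u"
  shows "\<forall>i\<in>set is. arg_ok arT arL i \<Longrightarrow>
    reds_tl (LSub (trA arT arL u) G (list_of arT arL is))
      (list_of arT arL (map (map_arg (pinst u)) is))"
  using assms
proof (induction arT arL "is" rule: list_of.induct)
  case (2 arT arL v "is")
  let ?u = "trA arT arL u"
  have "reds_tl (LSub ?u G (LCons (trA arT arL v) (list_of arT arL is)))
      (LCons (TSub ?u G (trA arT arL v)) (LSub ?u G (list_of arT arL is)))"
    by (rule red_intros)
  also have "reds_tl \<dots> (LCons (trA arT arL (pinst u v))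
      (list_of arT arL (map (map_arg (pinst u)) is)))"
    using 2 by (intro reds_congs TSub_trA) auto
  finally show ?case by simp
next
  case (3 arT arL b ts)
  let ?u = "trA arT arL u"
  have "reds_tl (LSub ?u G (LMeta b (map (trA arT arL) ts)))
      (LMeta b (map (TSub ?u G) (map (trA arT arL) ts)))"
    by (rule red_intros)
  also have "reds_tl \<dots> (LMeta b (map (trA arT arL) (map (pinst u) ts)))"
    using 3 by (intro reds_meta) (auto simp: list_all2_conv_all_nth intro!: TSub_trA)
  finally show ?case by simp
next
  case (4 arT arL b ts i "is")
  let ?u = "trA arT arL u"
  have "reds_tl (LSub ?u G (LMeta b (map (trA arT arL) ts)))
      (LMeta b (map (TSub ?u G) (map (trA arT arL) ts)))"
    by (rule red_intros)
  also have "reds_tl \<dots> (LMeta b (map (trA arT arL) (map (pinst u) ts)))"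
    using 4 by (intro reds_meta) (auto simp: list_all2_conv_all_nth intro!: TSub_trA)
  finally have 1: "reds_tl (LSub ?u G (LMeta b (map (trA arT arL) ts)))
    (LMeta b (map (trA arT arL) (map (pinst u) ts)))" .
  have "reds_tl (LSub ?u G (LCat (LMeta b (map (trA arT arL) ts)) (list_of arT arL (i # is))))
      (LCat (LSub ?u G (LMeta b (map (trA arT arL) ts))) (LSub ?u G (list_of arT arL (i # is))))"
    by (rule red_intros)
  also have "reds_tl \<dots> (LCat (LMeta b (map (trA arT arL) (map (pinst u) ts)))
      (list_of arT arL (map (map_arg (pinst u)) (i # is))))"
    using 4 by (intro reds_congs 1) auto
  finally show ?case by simp
qed (simp_all add: red_intros)

text \<open>Structural induction on terms and lists together: the components are normalised first,
  and the simulation lemmas then treat the outermost constructor.\<close>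

lemma reds_normal_form:
  fixes M :: "'s tm" and l :: "'s tl"
  shows "is_ptsc_tm arT arL M \<Longrightarrow> reds_tm M (trA arT arL (trB M))"
    and "is_ptsc_tl arT arL l \<Longrightarrow> reds_tl l (list_of arT arL (spine l))"
proof (induction M and l)
  case (TVar x l)
  then have "reds_tm (TVar x l) (trAl arT arL (list_of arT arL (spine l)) (PVar (Ord x)))"
    by (simp add: reds_congs)
  also have "reds_tm \<dots> (trA arT arL (trB (TVar x l)))"
    using TVar.prems trAl_list_of[OF spine_ok ptsa.var, of arT arL l x] by simp
  finally show ?case .
next
  case (TApp M l)
  then have "reds_tm (TApp M l) (TApp (trA arT arL (trB M)) (list_of arT arL (spine l)))"
    by (simp add: reds_congs)
  also have "reds_tm \<dots> (trAl arT arL (list_of arT arL (spine l)) (trB M))"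
    using TApp.prems by (intro TApp_trA ptsa_trB) simp
  also have "reds_tm \<dots> (trA arT arL (trB (TApp M l)))"
    using TApp.prems by (auto intro: trAl_list_of[OF spine_ok ptsa_trB])
  finally show ?case .
next
  case (TSub P K M)
  then have "reds_tm (TSub P K M) (TSub (trA arT arL (trB P)) K (trA arT arL (trB M)))"
    by (simp add: reds_congs)
  also have "reds_tm \<dots> (trA arT arL (trB (TSub P K M)))"
    using TSub.prems by (auto intro: TSub_trA ptsa_trB)
  finally show ?case .
next
  case (TMeta a Ms)
  then show ?case by (auto simp: list_all2_conv_all_nth intro!: reds_meta)
next
  case (LCat l l')
  then have "reds_tl (LCat l l') (LCat (list_of arT arL (spine l)) (list_of arT arL (spine l')))"
    by (simp add: reds_congs)
  also have "reds_tl \<dots> (list_of arT arL (spine (LCat l l')))"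
    using LCat_list_of by simp
  finally show ?case .
next
  case (LSub P K l)
  then have "reds_tl (LSub P K l) (LSub (trA arT arL (trB P)) K (list_of arT arL (spine l)))"
    by (simp add: reds_congs)
  also have "reds_tl \<dots> (list_of arT arL (spine (LSub P K l)))"
    using LSub.prems by (auto intro: LSub_list_of[OF ptsa_trB spine_ok])
  finally show ?case .
next
  case (LMeta b Ms)
  then show ?case by (auto simp: list_all2_conv_all_nth intro!: reds_meta)
qed (simp_all add: reds_congs)

theorem theorem2p7:
  fixes arT arL :: "nat \<Rightarrow> nat"
  shows "(\<forall>t :: 's pts. t \<in> PTSalpha arT arL \<longrightarrow> trB (trA arT arL t) = t) \<and>
         (\<forall>M :: 's tm. is_ptsc_tm arT arL M \<longrightarrow> red_tm\<^sup>*\<^sup>* M (trA arT arL (trB M)))"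
  using trB_trA reds_normal_form(1) by blast

end
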